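(* For every integer $n \ge 1$, $\mu_t(ST_3^n) = 3$. Moreover, a set $M \subseteq V(ST_3^n)$ is a total mutual-visibility set of $ST_3^n$ of cardinality $\mu_t(ST_3^n)$ if and only if $M = X(ST_3^n)$.
   Context: Sierpiński triangle graphs are defined recursively: $ST_3^0 = K_3$, whose three vertices are its extreme vertices, called top, left and right. For $n \ge 0$, $ST_3^{n+1}$ is obtained from three disjoint copies $T, L, R$ of $ST_3^n$ by identifying the left extreme vertex of $T$ with the top extreme vertex of $L$, the right extreme vertex of $T$ with the top extreme vertex of $R$, and the right extreme vertex of $L$ with the left extreme vertex of $R$; the extreme vertices of $ST_3^{n+1}$ are the top vertex of $T$, the left vertex of $L$ and the right vertex of $R$. $X(ST_3^n)$ denotes the set of the three extreme vertices of $ST_3^n$. For a graph $G$ and $M \subseteq V(G)$, vertices $u,v$ are $M$-visible if some shortest $u,v$-path in $G$ contains no vertex of $M \setminus \{u,v\}$. $M$ is a total mutual-visibility set of $G$ if every two vertices $u,v \in V(G)$ are $M$-visible. $\mu_t(G)$ is the largest cardinality of a total mutual-visibility set of $G$. *)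

theory Defs
  imports Main
begin

section \<open>Graphs, shortest paths, total mutual-visibility\<close>

text \<open>An edge of a simple undirected graph is the two-element set of its endpoints.\<close>

record 'a graph =
  verts :: "'a set"
  edges :: "'a set set"

definition is_path :: "'a graph \<Rightarrow> 'a \<Rightarrow> 'a \<Rightarrow> 'a list \<Rightarrow> bool" where
  "is_path G u v p \<longleftrightarrow>
     p \<noteq> [] \<and> hd p = u \<and> last p = v \<and> set p \<subseteq> verts G \<and> distinct p \<and>
     successively (\<lambda>x y. {x, y} \<in> edges G) p"

definition is_shortest_path :: "'a graph \<Rightarrow> 'a \<Rightarrow> 'a \<Rightarrow> 'a list \<Rightarrow> bool" where
  "is_shortest_path G u v p \<longleftrightarrow>
     is_path G u v p \<and> (\<forall>q. is_path G u v q \<longrightarrow> length p \<le> length q)"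

definition visible :: "'a graph \<Rightarrow> 'a set \<Rightarrow> 'a \<Rightarrow> 'a \<Rightarrow> bool" where
  "visible G M u v \<longleftrightarrow>
     (\<exists>p. is_shortest_path G u v p \<and> set p \<inter> (M - {u, v}) = {})"

definition total_mutual_visibility_set :: "'a graph \<Rightarrow> 'a set \<Rightarrow> bool" where
  "total_mutual_visibility_set G M \<longleftrightarrow>
     M \<subseteq> verts G \<and> (\<forall>u\<in>verts G. \<forall>v\<in>verts G. visible G M u v)"

definition mu_t :: "'a graph \<Rightarrow> nat" where
  "mu_t G = Max {card M | M. total_mutual_visibility_set G M}"


section \<open>Sierpinski triangle graphs\<close>

text \<open>
  A vertex of \<open>ST n\<close> is a word of length \<open>n + 1\<close>. Its last letter is a vertex of the initial
  triangle; every earlier letter says which of the three copies is entered, outermost first.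
  Prefixing the letters \<open>Top\<close>, \<open>Left\<close>, \<open>Right\<close> thus yields the disjoint copies T, L, R.
\<close>

datatype corner = Top | Left | Right

type_synonym vertex = "corner list"

text \<open>The extreme vertices: the top vertex of T, the left vertex of L, the right vertex of R.\<close>

primrec extreme :: "nat \<Rightarrow> corner \<Rightarrow> vertex" where
  "extreme 0 c = [c]"
| "extreme (Suc n) c = c # extreme n c"

text \<open>
  The three identifications made in passing from \<open>ST n\<close> to \<open>ST (Suc n)\<close>. The quotient is
  represented by choosing one word in each of the three identified pairs; \<open>glue n\<close> sends every
  vertex of the disjoint union of the copies to the chosen representative of its class.
\<close>

definition glue :: "nat \<Rightarrow> vertex \<Rightarrow> vertex" where
  "glue n w =
     (if w = Left # extreme n Top then Top # extreme n Left
      else if w = Right # extreme n Top then Top # extreme n Right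
      else if w = Right # extreme n Left then Left # extreme n Right
      else w)"

primrec ST :: "nat \<Rightarrow> vertex graph" where
  "ST 0 =
     \<lparr> verts = {[Top], [Left], [Right]},
       edges = {{[Top], [Left]}, {[Top], [Right]}, {[Left], [Right]}} \<rparr>"
| "ST (Suc n) =
     \<lparr> verts = {glue n (c # w) | c w. w \<in> verts (ST n)},
       edges = {{glue n (c # w), glue n (c # w')} | c w w'. {w, w'} \<in> edges (ST n)} \<rparr>"

definition extreme_vertices :: "nat \<Rightarrow> vertex set" where
  "extreme_vertices n = {extreme n Top, extreme n Left, extreme n Right}"

end

theory Submission
  imports Defs
begin

text \<open>
  The two neighbours of an extreme vertex are adjacent, so an extreme vertex is never interior to a
  shortest path; as \<open>ST n\<close> is connected, the three extreme vertices form a total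
  mutual-visibility set. Conversely, every other vertex \<open>v\<close> arises from gluing two copies in some
  round. Neighbours of \<open>v\<close> taken from the two copies, each outside all other copies, have \<open>v\<close> as
  their only common neighbour, so \<open>v\<close> lies in no total mutual-visibility set.
\<close>

section \<open>Shortest paths\<close>

abbreviation adj :: "'a graph \<Rightarrow> 'a \<Rightarrow> 'a \<Rightarrow> bool" where
  "adj G x y \<equiv> {x, y} \<in> edges G"

lemma adj_sym: "adj G x y \<Longrightarrow> adj G y x"
  by (simp add: insert_commute)

definition simplicial :: "'a graph \<Rightarrow> 'a \<Rightarrow> bool" where
  "simplicial G x \<longleftrightarrow> (\<forall>a b. adj G a x \<longrightarrow> adj G x b \<longrightarrow> a \<noteq> b \<longrightarrow> adj G a b)"

text \<open>In a loopless graph this makes \<open>a\<close>, \<open>v\<close>, \<open>b\<close> the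
  only shortest path between its ends, so that \<open>v\<close> obstructs the pair \<open>a\<close>,
  \<open>b\<close>.\<close>

definition unique_midpoint :: "'a graph \<Rightarrow> 'a \<Rightarrow> bool" where
  "unique_midpoint G v \<longleftrightarrow>
     (\<exists>a b. adj G a v \<and> adj G v b \<and> a \<noteq> b \<and> \<not> adj G a b \<and>
        (\<forall>x. adj G a x \<longrightarrow> adj G x b \<longrightarrow> x = v))"

lemma is_path_snoc:
  assumes "is_path G u v p" "adj G v w" "w \<in> verts G"
  shows "\<exists>q. is_path G u w q"
proof (cases "w \<in> set p")
  case True
  \<comment> \<open>Paths may not repeat vertices, so instead of appending \<open>w\<close> the path
    is cut off at \<open>w\<close>.\<close>
  then obtain xs ys where "p = xs @ w # ys" by (meson split_list)
  then have "is_path G u w (xs @ [w])"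
    using assms(1)
    by (auto simp: is_path_def successively_append_iff hd_append split: if_splits)
  then show ?thesis by blast
next
  case False
  then have "is_path G u w (p @ [w])"
    using assms by (auto simp: is_path_def successively_append_iff)
  then show ?thesis by blast
qed

text \<open>Reachability composes freely, whereas paths must stay distinct; connectedness is
  therefore proved for the closure and converted here.\<close>

lemma rtranclp_adj_imp_is_path:
  assumes "(adj G)\<^sup>*\<^sup>* u v" "u \<in> verts G" "\<And>x y. adj G x y \<Longrightarrow> y \<in> verts G"
  shows "\<exists>p. is_path G u v p"
  using assms(1)
proof (induction rule: rtranclp_induct)
  case base
  have "is_path G u u [u]" using assms(2) by (simp add: is_path_def)
  then show ?case by blast
next
  case (step y z)
  then show ?case using is_path_snoc assms(3) by metis
qed

lemma ex_shortest_path: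
  assumes "is_path G u v p"
  shows "\<exists>q. is_shortest_path G u v q"
  using ex_has_least_nat[of "is_path G u v" p length] assms
  unfolding is_shortest_path_def by blast

text \<open>The two path neighbours of an interior simplicial vertex are adjacent, so skipping it
  would give a shorter path.\<close>

lemma shortest_path_avoids_simplicial:
  assumes "is_shortest_path G u v p" "x \<in> set p" "simplicial G x"
  shows "x = u \<or> x = v"
proof (rule ccontr)
  assume neq: "\<not> (x = u \<or> x = v)"
  have p: "is_path G u v p" using assms(1) by (simp add: is_shortest_path_def)
  obtain xs ys where xy: "p = xs @ x # ys" using assms(2) by (meson split_list)
  have "xs \<noteq> []" "ys \<noteq> []" using neq p xy by (auto simp: is_path_def)
  then obtain xs' a b ys' where eq: "xs = xs' @ [a]" "ys = b # ys'"
    by (meson neq_Nil_conv rev_exhaust)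
  have "adj G a x" "adj G x b" "a \<noteq> b"
    using p unfolding xy eq is_path_def by (auto simp: successively_append_iff)
  then have "adj G a b" using assms(3) unfolding simplicial_def by blast
  then have "is_path G u v (xs' @ a # b # ys')"
    using p unfolding xy eq is_path_def
    by (auto simp: successively_append_iff hd_append split: if_splits)
  then have "length p \<le> length (xs' @ a # b # ys')"
    using assms(1) unfolding is_shortest_path_def by blast
  then show False by (simp add: xy eq)
qed

lemma unique_midpoint_not_in_total_mutual_visibility_set:
  assumes "unique_midpoint G v" "total_mutual_visibility_set G M"
    and wf: "\<And>x y. adj G x y \<Longrightarrow> x \<in> verts G \<and> x \<noteq> y"
  shows "v \<notin> M"
proof
  assume "v \<in> M"
  obtain a b where ab: "adj G a v" "adj G v b" "a \<noteq> b" "\<not> adj G a b"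
    and uniq: "\<And>x. adj G a x \<Longrightarrow> adj G x b \<Longrightarrow> x = v"
    using assms(1) unfolding unique_midpoint_def by blast
  \<comment> \<open>Since \<open>v\<close> differs from both ends, visibility of \<open>a\<close>
    and \<open>b\<close> does not exempt it.\<close>
  have V: "a \<in> verts G" "v \<in> verts G" "b \<in> verts G" "v \<noteq> a" "v \<noteq> b"
    using wf ab adj_sym by metis+
  obtain p where p: "is_shortest_path G a b p" "set p \<inter> (M - {a, b}) = {}"
    using assms(2) V unfolding total_mutual_visibility_set_def visible_def by blast
  \<comment> \<open>This path bounds the length of \<open>p\<close> by three. Fewer vertices are
    ruled out by \<open>a\<close> and \<open>b\<close> being distinct and not adjacent, and with
    three the middle one is \<open>v\<close>.\<close>
  have "is_path G a b [a, v, b]" using ab V by (auto simp: is_path_def)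
  then have len: "length p \<le> 3" using p(1) unfolding is_shortest_path_def by fastforce
  have path: "is_path G a b p" using p(1) by (simp add: is_shortest_path_def)
  consider "p = []" | x where "p = [x]" | x y where "p = [x, y]" | x y z where "p = [x, y, z]"
    using len by (auto simp: numeral_eq_Suc le_Suc_eq length_Suc_conv)
  then show False
  proof cases
    case 4
    then have "y = v" using path uniq[of y] by (auto simp: is_path_def)
    then show False using p(2) \<open>v \<in> M\<close> V 4 by auto
  qed (use path ab in \<open>auto simp: is_path_def\<close>)
qed


section \<open>Gluing three copies\<close>

lemma extreme_eq_iff [simp]: "extreme n c = extreme n d \<longleftrightarrow> c = d"
  by (induction n) auto

text \<open>A symmetric description of the identified pairs that hides which representative
  \<open>glue\<close> picks: corner \<open>d\<close> of copy \<open>c\<close> is corner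
  \<open>c\<close> of copy \<open>d\<close>.\<close>

lemma glue_eq_iff:
  "glue n (c # w) = glue n (d # w') \<longleftrightarrow>
     c = d \<and> w = w' \<or> c \<noteq> d \<and> w = extreme n d \<and> w' = extreme n c"
  by (cases c; cases d) (auto simp: glue_def)

text \<open>Corner \<open>c\<close> of copy \<open>c\<close> is never identified with anything. In
  this form extreme vertices can be treated by \<open>glue_eq_iff\<close>.\<close>

lemma extreme_Suc_glue: "extreme (Suc n) c = glue n (c # extreme n c)"
  by (cases c) (auto simp: glue_def)

declare extreme.simps(2) [simp del]

lemma adj_ST_Suc_iff:
  "adj (ST (Suc n)) x y \<longleftrightarrow>
     (\<exists>c w w'. adj (ST n) w w' \<and> x = glue n (c # w) \<and> y = glue n (c # w'))"
proof
  assume "adj (ST (Suc n)) x y"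
  then obtain c w w' where "adj (ST n) w w'" "{x, y} = {glue n (c # w), glue n (c # w')}"
    by auto
  \<comment> \<open>The unordered pairs may match crosswise, in which case \<open>w\<close> and
    \<open>w'\<close> are exchanged.\<close>
  then show "\<exists>c w w'. adj (ST n) w w' \<and> x = glue n (c # w) \<and> y = glue n (c # w')"
    using adj_sym[of w w' "ST n"] by (auto simp: doubleton_eq_iff)
qed auto

text \<open>The second disjunct arises when the vertex is a glued one: it then also has the
  neighbours of its other representative, in copy \<open>d\<close>.\<close>

lemma adj_ST_Suc_glue_iff:
  "adj (ST (Suc n)) (glue n (c # w)) y \<longleftrightarrow>
     (\<exists>w'. adj (ST n) w w' \<and> y = glue n (c # w')) \<or>
     (\<exists>d w'. d \<noteq> c \<and> w = extreme n d \<and> adj (ST n) (extreme n c) w' \<and> y = glue n (d # w'))"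
  unfolding adj_ST_Suc_iff glue_eq_iff by auto

lemma verts_ST_Suc_iff: "x \<in> verts (ST (Suc n)) \<longleftrightarrow> (\<exists>c w. w \<in> verts (ST n) \<and> x = glue n (c # w))"
  by auto

declare ST.simps(2) [simp del]

lemma adj_ST_0_iff: "adj (ST 0) x y \<longleftrightarrow> (\<exists>c d. x = [c] \<and> y = [d] \<and> c \<noteq> d)"
proof
  assume "\<exists>c d. x = [c] \<and> y = [d] \<and> c \<noteq> d"
  then obtain c d where "x = [c]" "y = [d]" "c \<noteq> d" by blast
  then show "adj (ST 0) x y" by (cases c; cases d) (auto simp: doubleton_eq_iff)
qed (auto simp: doubleton_eq_iff)

lemma verts_ST_0_iff: "x \<in> verts (ST 0) \<longleftrightarrow> (\<exists>c. x = [c])"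
proof
  assume "\<exists>c. x = [c]"
  then obtain c where "x = [c]" by blast
  then show "x \<in> verts (ST 0)" by (cases c) auto
qed auto

declare ST.simps(1) [simp del]

lemma adj_ST_wf: "adj (ST n) x y \<Longrightarrow> x \<in> verts (ST n) \<and> x \<noteq> y"
proof (induction n arbitrary: x y)
  case 0
  then show ?case by (auto simp: adj_ST_0_iff verts_ST_0_iff)
next
  case (Suc n)
  then show ?case unfolding adj_ST_Suc_iff verts_ST_Suc_iff by (auto simp: glue_eq_iff)
qed

section \<open>Extreme vertices and their neighbourhoods\<close>

lemma extreme_in_verts_ST: "extreme n c \<in> verts (ST n)"
  by (induction n) (auto simp: verts_ST_0_iff verts_ST_Suc_iff extreme_Suc_glue)

lemma extreme_vertices_eq_range: "extreme_vertices n = range (extreme n)"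
proof -
  have "extreme n c \<in> extreme_vertices n" for c
    by (cases c) (simp_all add: extreme_vertices_def)
  then show ?thesis unfolding extreme_vertices_def by blast
qed

lemma card_extreme_vertices: "card (extreme_vertices n) = 3"
  by (simp add: extreme_vertices_def)

lemma adj_ST_extreme_Suc_iff:
  "adj (ST (Suc n)) (extreme (Suc n) c) y \<longleftrightarrow>
     (\<exists>w. adj (ST n) (extreme n c) w \<and> y = glue n (c # w))"
  unfolding extreme_Suc_glue adj_ST_Suc_glue_iff by auto

text \<open>All neighbours of corner \<open>c\<close> lie in copy \<open>c\<close>, which contains
  no other extreme vertex of the new graph. At level 0 the corners are adjacent, hence the successor
  index.\<close>

lemma not_adj_ST_extreme_Suc: "\<not> adj (ST (Suc n)) (extreme (Suc n) c) (extreme (Suc n) d)"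
proof
  assume *: "adj (ST (Suc n)) (extreme (Suc n) c) (extreme (Suc n) d)"
  then have "c = d"
    unfolding adj_ST_extreme_Suc_iff by (auto simp: extreme_Suc_glue glue_eq_iff)
  then show False using adj_ST_wf[OF *] by simp
qed

text \<open>All neighbours of an extreme vertex lie in a single copy, where it is again extreme, so
  the property is inherited from the previous level.\<close>

lemma simplicial_extreme: "simplicial (ST n) (extreme n c)"
proof (induction n)
  case 0
  then show ?case by (auto simp: simplicial_def adj_ST_0_iff)
next
  case (Suc n)
  show ?case unfolding simplicial_def
  proof (intro allI impI)
    fix a b
    assume "adj (ST (Suc n)) a (extreme (Suc n) c)" "adj (ST (Suc n)) (extreme (Suc n) c) b" "a \<noteq> b"
    then obtain w w' where w: "adj (ST n) (extreme n c) w" "a = glue n (c # w)"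
      "adj (ST n) (extreme n c) w'" "b = glue n (c # w')"
      using adj_sym adj_ST_extreme_Suc_iff by metis
    then have "adj (ST n) w w'"
      using Suc \<open>a \<noteq> b\<close> adj_sym[OF w(1)] unfolding simplicial_def by metis
    then show "adj (ST (Suc n)) a b" using w adj_ST_Suc_iff by blast
  qed
qed

section \<open>Connectedness, and visibility for the set of extreme vertices\<close>

lemma glue_rtranclp_adj:
  "(adj (ST n))\<^sup>*\<^sup>* w w' \<Longrightarrow> (adj (ST (Suc n)))\<^sup>*\<^sup>* (glue n (c # w)) (glue n (c # w'))"
proof (induction rule: rtranclp_induct)
  case (step y z)
  then have "adj (ST (Suc n)) (glue n (c # y)) (glue n (c # z))"
    using adj_ST_Suc_iff by blast
  with step.IH show ?case by (rule rtranclp.rtrancl_into_rtrancl)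
qed simp

lemma ST_connected:
  "u \<in> verts (ST n) \<Longrightarrow> v \<in> verts (ST n) \<Longrightarrow> (adj (ST n))\<^sup>*\<^sup>* u v"
proof (induction n arbitrary: u v)
  case 0
  then show ?case
    by (cases "u = v") (auto simp: verts_ST_0_iff adj_ST_0_iff intro!: r_into_rtranclp)
next
  case (Suc n)
  obtain c w d w' where w: "w \<in> verts (ST n)" "u = glue n (c # w)"
      "w' \<in> verts (ST n)" "v = glue n (d # w')"
    using Suc.prems unfolding verts_ST_Suc_iff by blast
  show ?case
  proof (cases "c = d")
    case True
    then show ?thesis using w Suc.IH glue_rtranclp_adj by metis
  next
    case False
    \<comment> \<open>The walk passes from copy \<open>c\<close> to copy \<open>d\<close> through
      the vertex that they share.\<close>
    have "(adj (ST (Suc n)))\<^sup>*\<^sup>* u (glue n (c # extreme n d))"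
      unfolding w by (intro glue_rtranclp_adj Suc.IH w extreme_in_verts_ST)
    also have "glue n (c # extreme n d) = glue n (d # extreme n c)"
      using False by (simp add: glue_eq_iff)
    also have "(adj (ST (Suc n)))\<^sup>*\<^sup>* \<dots> v"
      unfolding w by (intro glue_rtranclp_adj Suc.IH w extreme_in_verts_ST)
    finally show ?thesis .
  qed
qed

lemma total_mutual_visibility_set_extreme_vertices:
  "total_mutual_visibility_set (ST n) (extreme_vertices n)"
  unfolding total_mutual_visibility_set_def
proof (intro conjI ballI)
  show "extreme_vertices n \<subseteq> verts (ST n)"
    using extreme_in_verts_ST by (auto simp: extreme_vertices_eq_range)
next
  fix u v assume uv: "u \<in> verts (ST n)" "v \<in> verts (ST n)"
  have "\<And>x y. adj (ST n) x y \<Longrightarrow> y \<in> verts (ST n)"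
    using adj_ST_wf adj_sym by metis
  then obtain p where "is_shortest_path (ST n) u v p"
    using rtranclp_adj_imp_is_path ST_connected[OF uv] uv ex_shortest_path by metis
  then show "visible (ST n) (extreme_vertices n) u v"
    using shortest_path_avoids_simplicial simplicial_extreme
    unfolding visible_def extreme_vertices_eq_range by fastforce
qed


section \<open>Glued vertices\<close>

text \<open>Inside copy \<open>c\<close> the glued vertices are the \<open>extreme n e\<close> with
  \<open>e \<noteq> c\<close>, so \<open>a\<close> is a neighbour of the glued vertex that lies in
  no other copy. The exception for \<open>c\<close> is essential at level 0, where
  \<open>[c]\<close> is the only choice.\<close>

lemma ex_adj_extreme:
  assumes "c \<noteq> d"
  shows "\<exists>a. adj (ST n) a (extreme n d) \<and> (\<forall>e. e \<noteq> c \<longrightarrow> a \<noteq> extreme n e)"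
proof (cases n)
  case 0
  then have "adj (ST n) [c] (extreme n d) \<and> (\<forall>e. e \<noteq> c \<longrightarrow> [c] \<noteq> extreme n e)"
    using assms by (auto simp: adj_ST_0_iff)
  then show ?thesis by blast
next
  case (Suc m)
  \<comment> \<open>From level 1 on any neighbour will do, because extreme vertices are pairwise not
    adjacent.\<close>
  have "\<exists>a. adj (ST k) (extreme k d) a" for k
  proof (induction k)
    case 0
    then show ?case using assms by (auto simp: adj_ST_0_iff)
  next
    case (Suc k)
    then show ?case unfolding adj_ST_extreme_Suc_iff by blast
  qed
  then show ?thesis using not_adj_ST_extreme_Suc adj_sym Suc by metis
qed

lemma unique_midpoint_glued:
  assumes "c \<noteq> d"
  shows "unique_midpoint (ST (Suc n)) (glue n (c # extreme n d))"
proof -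
  have glued: "glue n (c # extreme n d) = glue n (d # extreme n c)"
    using assms by (simp add: glue_eq_iff)
  obtain a where a: "adj (ST n) a (extreme n d)" "\<And>e. e \<noteq> c \<Longrightarrow> a \<noteq> extreme n e"
    using ex_adj_extreme assms by metis
  obtain b where b: "adj (ST n) b (extreme n c)" "\<And>e. e \<noteq> d \<Longrightarrow> b \<noteq> extreme n e"
    using ex_adj_extreme assms by metis
  \<comment> \<open>As \<open>a\<close> is not glued to another copy, all its neighbours come from
    copy \<open>c\<close>; likewise those of \<open>b\<close> come from copy \<open>d\<close>. The
    two copies meet only in the glued vertex.\<close>
  have nbr_a: "\<exists>w. adj (ST n) a w \<and> x = glue n (c # w)"
    if "adj (ST (Suc n)) (glue n (c # a)) x" for x
    using that a(2) unfolding adj_ST_Suc_glue_iff by blast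
  have nbr_b: "\<exists>w. adj (ST n) b w \<and> x = glue n (d # w)"
    if "adj (ST (Suc n)) x (glue n (d # b))" for x
    using adj_sym[OF that] b(2) unfolding adj_ST_Suc_glue_iff by blast
  show ?thesis unfolding unique_midpoint_def
  proof (intro exI conjI allI impI)
    show "adj (ST (Suc n)) (glue n (c # a)) (glue n (c # extreme n d))"
      using a(1) adj_ST_Suc_iff by blast
    show "adj (ST (Suc n)) (glue n (c # extreme n d)) (glue n (d # b))"
      using adj_sym[OF b(1)] adj_ST_Suc_iff unfolding glued by blast
    show "glue n (c # a) \<noteq> glue n (d # b)"
      using assms a(2) by (auto simp: glue_eq_iff)
    \<comment> \<open>An edge would place \<open>b\<close> in copy \<open>c\<close> as well, forcing
      \<open>b = extreme n c\<close>.\<close>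
    show "\<not> adj (ST (Suc n)) (glue n (c # a)) (glue n (d # b))"
      using nbr_a[of "glue n (d # b)"] assms b(2)[of c] by (auto simp: glue_eq_iff)
    fix x assume "adj (ST (Suc n)) (glue n (c # a)) x" "adj (ST (Suc n)) x (glue n (d # b))"
    then show "x = glue n (c # extreme n d)"
      using nbr_a nbr_b assms by (fastforce simp: glue_eq_iff)
  qed
qed

text \<open>
  The index \<open>Suc m\<close> matters: in \<open>ST 0\<close> the extreme vertices are adjacent, so a common neighbour
  of two vertices of a copy could be the vertex glued from the two other copies.
\<close>

lemma unique_midpoint_glue:
  assumes n: "n = Suc m" and "unique_midpoint (ST n) v"
  shows "unique_midpoint (ST (Suc n)) (glue n (c # v))"
proof -
  obtain a b where ab: "adj (ST n) a v" "adj (ST n) v b" "a \<noteq> b" "\<not> adj (ST n) a b"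
    and uniq: "\<And>x. adj (ST n) a x \<Longrightarrow> adj (ST n) x b \<Longrightarrow> x = v"
    using assms(2) unfolding unique_midpoint_def by blast
  have ext: "\<not> adj (ST n) (extreme n e) (extreme n f)" for e f
    using not_adj_ST_extreme_Suc n by simp
  have ba: "\<not> adj (ST n) b a" using ab(4) adj_sym by metis
  show ?thesis unfolding unique_midpoint_def
  proof (intro exI conjI allI impI)
    show "adj (ST (Suc n)) (glue n (c # a)) (glue n (c # v))"
      "adj (ST (Suc n)) (glue n (c # v)) (glue n (c # b))"
      using ab adj_ST_Suc_iff by blast+
    show "glue n (c # a) \<noteq> glue n (c # b)"
      using ab by (auto simp: glue_eq_iff)
    show "\<not> adj (ST (Suc n)) (glue n (c # a)) (glue n (c # b))"
      using ab ext unfolding adj_ST_Suc_glue_iff by (auto simp: glue_eq_iff)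
    fix x
    assume x: "adj (ST (Suc n)) (glue n (c # a)) x" "adj (ST (Suc n)) x (glue n (c # b))"
    note x' = x(1) adj_sym[OF x(2)]
    \<comment> \<open>If \<open>x\<close> is reached from both ends inside copy \<open>c\<close>,
      uniqueness in \<open>ST n\<close> applies. Every detour through another copy forces
      \<open>a = b\<close> or an edge between extreme vertices of \<open>ST n\<close>.\<close>
    show "x = glue n (c # v)"
      using x'[unfolded adj_ST_Suc_glue_iff]
    proof (elim disjE exE conjE)
      fix w w'
      assume "adj (ST n) a w" "x = glue n (c # w)" "adj (ST n) b w'" "x = glue n (c # w')"
      then show ?thesis using uniq adj_sym by (auto simp: glue_eq_iff insert_commute)
    qed (use ab ba ext in \<open>auto simp: glue_eq_iff\<close>)
  qed
qed

lemma unique_midpoint_if_not_extreme: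
  "v \<in> verts (ST n) \<Longrightarrow> v \<notin> extreme_vertices n \<Longrightarrow> unique_midpoint (ST n) v"
proof (induction n arbitrary: v)
  case 0
  then show ?case by (auto simp: verts_ST_0_iff extreme_vertices_eq_range)
next
  case (Suc n)
  then obtain c w where w: "w \<in> verts (ST n)" "v = glue n (c # w)"
    unfolding verts_ST_Suc_iff by blast
  show ?case
  proof (cases "w \<in> extreme_vertices n")
    case True
    then obtain d where "w = extreme n d" by (auto simp: extreme_vertices_eq_range)
    \<comment> \<open>With \<open>c = d\<close> the vertex \<open>v\<close> would be extreme; hence
      it is a glued vertex.\<close>
    moreover from this have "c \<noteq> d"
      using Suc.prems(2) w(2) by (auto simp: extreme_vertices_eq_range extreme_Suc_glue)
    ultimately show ?thesis using unique_midpoint_glued w(2) by simp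
  next
    case False
    \<comment> \<open>At level 0 every vertex is extreme, so a non-extreme \<open>w\<close> supplies
      the successor index needed for lifting its midpoint property.\<close>
    then have "n \<noteq> 0"
      using w(1) by (cases n) (auto simp: verts_ST_0_iff extreme_vertices_eq_range)
    then show ?thesis
      using unique_midpoint_glue Suc.IH[OF w(1) False] w(2) not0_implies_Suc by metis
  qed
qed

section \<open>The upper bound and the sets attaining it\<close>

lemma total_mutual_visibility_set_subset_extreme_vertices:
  assumes "total_mutual_visibility_set (ST n) M"
  shows "M \<subseteq> extreme_vertices n"
proof
  fix v assume "v \<in> M"
  then have "v \<in> verts (ST n)" using assms unfolding total_mutual_visibility_set_def by blast
  then show "v \<in> extreme_vertices n"
    using unique_midpoint_if_not_extreme unique_midpoint_not_in_total_mutual_visibility_set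
      adj_ST_wf assms \<open>v \<in> M\<close> by metis
qed

theorem theorem4:
  fixes n :: nat
  assumes "n \<ge> 1"
  shows "mu_t (ST n) = 3 \<and>
    (\<forall>M. M \<subseteq> verts (ST n) \<longrightarrow>
      (total_mutual_visibility_set (ST n) M \<and> card M = mu_t (ST n) \<longleftrightarrow> M = extreme_vertices n))"
proof -
  let ?X = "extreme_vertices n"
  have fin: "finite ?X" by (simp add: extreme_vertices_def)
  have le: "card M \<le> 3" if "total_mutual_visibility_set (ST n) M" for M
    using card_mono[OF fin total_mutual_visibility_set_subset_extreme_vertices[OF that]]
    by (simp add: card_extreme_vertices)
  have "mu_t (ST n) = 3"
    unfolding mu_t_def
  proof (rule Max_eqI)
    show "finite {card M |M. total_mutual_visibility_set (ST n) M}"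
      by (rule finite_subset[of _ "{..3}"]) (use le in auto)
    show "3 \<in> {card M |M. total_mutual_visibility_set (ST n) M}"
      using total_mutual_visibility_set_extreme_vertices[of n] card_extreme_vertices[of n] by force
  qed (use le in auto)
  \<comment> \<open>A total mutual-visibility set of cardinality 3 lies in the 3-element set
    \<open>?X\<close> and hence equals it.\<close>
  then show ?thesis
    using total_mutual_visibility_set_extreme_vertices[of n] card_extreme_vertices[of n]
      total_mutual_visibility_set_subset_extreme_vertices card_subset_eq[OF fin] by metis
qed

end
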